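(* Let $\mathcal{F}=(S,\mathcal{I})$ be the combination of independence systems $(S_j,\mathcal{I}_j)$, $j\in[M]$, where each $(S_j,\mathcal{I}_j)$ is a $k_j$-growth system, and let $\mathrm{Core}$ be the core of this combination with respect to an injective weight function $w:S\to\mathbb{R}_{\ge0}$. Let $k=\max_{e\in S}\sum_{j:\,e\in S_j}k_j$, and let $Y=Y(p)$ be a random set containing each element of $S$ independently with probability $p$, for some $p\in(0,1]$. Then $$\mathbb{E}\big[w(\mathrm{Core}(\mathrm{Rel}(Y)))\big]\ \ge\ \frac{(p-(1-p)k)(1-p)}{p^2}\ \mathbb{E}\big[w(\mathrm{Greedy}(Y))\big].$$ Furthermore, if all components are matroids (i.e. $\mathcal{F}$ is a $k$-matchoid, with all $k_j=1$), then $$\mathbb{E}\big[w(\mathrm{Core}(\mathrm{Rel}(Y)))\big]\ \ge\ \frac{(p-(1-p)(k-1))(1-p)}{p}\ \mathbb{E}\big[w(\mathrm{Greedy}(Y))\big].$$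
   Context: An independence system $(S,\mathcal{I})$ is a finite set $S$ with a nonempty downward-closed family $\mathcal{I}\subseteq 2^S$ of independent sets; circuits are minimal non-independent sets; a basis of $X\subseteq S$ is a maximal independent subset of $X$. Write $X+e=X\cup\{e\}$ and $w(X)=\sum_{x\in X}w(x)$. Combination: the combination of $(S_j,\mathcal{I}_j)$, $j\in[M]$, is $(S,\mathcal{I})$ with $S=\bigcup_j S_j$ and $\mathcal{I}=\{I\subseteq S: I\cap S_j\in\mathcal{I}_j\ \forall j\}$. $k$-growth system ($k$ a positive integer): for all $X\subseteq S$ and all $I\in\mathcal{I}$ there is a partition $(Q,Z)$ of $I\setminus X$ with $|Z|\le k|X\setminus I|$ such that $P\cup Q\in\mathcal{I}$ for every basis $P$ of $X$. (The 1-growth systems are exactly matroids.) Primitive hull of component $j$: for $X\subseteq S_j$, $\mathrm{PHull}_j(X)=X\cup\{e\in S_j: e \text{ belongs to some circuit of }(S_j,\mathcal{I}_j)\text{ contained in }X+e\}$. Primitive core: $\mathrm{PCore}_j(X)=\{e\in X: e\notin\mathrm{PHull}_j(\{f\in X:w(f)>w(e)\})\}$. Core: for $X\subseteq S$, $\mathrm{Core}(X)=\bigcap_{j=1}^M\big((X\setminus S_j)\cup\mathrm{PCore}_j(X\cap S_j)\big)$. $\mathrm{Greedy}(X)$: process the elements of $X$ in decreasing order of $w$, starting from $\emptyset$, adding an element whenever the current set stays in $\mathcal{I}$; $\mathrm{Greedy}(X)$ is the final set. $\mathrm{Rel}(Y)=\{y\in S\setminus Y: y\in\mathrm{Greedy}(Y+y)\}$.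 *)

theory Defs
  imports "HOL-Probability.Probability"
begin

definition indep_system :: "'a set \<Rightarrow> 'a set set \<Rightarrow> bool" where
  "indep_system S \<I> \<longleftrightarrow> finite S \<and> \<I> \<noteq> {} \<and> \<I> \<subseteq> Pow S \<and> (\<forall>A B. A \<in> \<I> \<and> B \<subseteq> A \<longrightarrow> B \<in> \<I>)"

definition circuit :: "'a set \<Rightarrow> 'a set set \<Rightarrow> 'a set \<Rightarrow> bool" where
  "circuit S \<I> C \<longleftrightarrow> C \<subseteq> S \<and> C \<notin> \<I> \<and> (\<forall>D. D \<subset> C \<longrightarrow> D \<in> \<I>)"

definition basis_of :: "'a set set \<Rightarrow> 'a set \<Rightarrow> 'a set \<Rightarrow> bool" where
  "basis_of \<I> X P \<longleftrightarrow> P \<subseteq> X \<and> P \<in> \<I> \<and> (\<forall>P'. P \<subset> P' \<and> P' \<subseteq> X \<longrightarrow> P' \<notin> \<I>)"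

definition matroid :: "'a set \<Rightarrow> 'a set set \<Rightarrow> bool" where
  "matroid S \<I> \<longleftrightarrow> indep_system S \<I> \<and>
     (\<forall>A\<in>\<I>. \<forall>B\<in>\<I>. card A < card B \<longrightarrow> (\<exists>e\<in>B - A. insert e A \<in> \<I>))"

definition growth_system :: "nat \<Rightarrow> 'a set \<Rightarrow> 'a set set \<Rightarrow> bool" where
  "growth_system k S \<I> \<longleftrightarrow> 0 < k \<and> indep_system S \<I> \<and>
     (\<forall>X\<subseteq>S. \<forall>I\<in>\<I>. \<exists>Q Z. Q \<union> Z = I - X \<and> Q \<inter> Z = {} \<and> card Z \<le> k * card (X - I) \<and>
        (\<forall>P. basis_of \<I> X P \<longrightarrow> P \<union> Q \<in> \<I>))"

definition comb_ground :: "nat \<Rightarrow> (nat \<Rightarrow> 'a set) \<Rightarrow> 'a set" where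
  "comb_ground M S = (\<Union>j\<in>{1..M}. S j)"

definition comb_indep :: "nat \<Rightarrow> (nat \<Rightarrow> 'a set) \<Rightarrow> (nat \<Rightarrow> 'a set set) \<Rightarrow> 'a set set" where
  "comb_indep M S \<I> = {I. I \<subseteq> comb_ground M S \<and> (\<forall>j\<in>{1..M}. I \<inter> S j \<in> \<I> j)}"

definition PHull :: "'a set \<Rightarrow> 'a set set \<Rightarrow> 'a set \<Rightarrow> 'a set" where
  "PHull S \<I> X = X \<union> {e \<in> S. \<exists>C. circuit S \<I> C \<and> e \<in> C \<and> C \<subseteq> insert e X}"

definition PCore :: "'a set \<Rightarrow> 'a set set \<Rightarrow> ('a \<Rightarrow> real) \<Rightarrow> 'a set \<Rightarrow> 'a set" where
  "PCore S \<I> w X = {e \<in> X. e \<notin> PHull S \<I> {f \<in> X. w f > w e}}"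

text \<open>Every set in the intersection below is contained in \<open>X\<close>, so intersecting with \<open>X\<close> only
  matters for \<open>M = 0\<close>, where the empty intersection would otherwise be the whole type.\<close>

definition Core ::
  "nat \<Rightarrow> (nat \<Rightarrow> 'a set) \<Rightarrow> (nat \<Rightarrow> 'a set set) \<Rightarrow> ('a \<Rightarrow> real) \<Rightarrow> 'a set \<Rightarrow> 'a set" where
  "Core M S \<I> w X = X \<inter> (\<Inter>j\<in>{1..M}. (X - S j) \<union> PCore (S j) (\<I> j) w (X \<inter> S j))"

text \<open>The list is sorted by increasing weight, hence the reversal. Ties are not an issue,
  since \<open>w\<close> will be injective on the ground set.\<close>

definition Greedy :: "'a set set \<Rightarrow> ('a \<Rightarrow> real) \<Rightarrow> 'a set \<Rightarrow> 'a set" where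
  "Greedy \<I> w X =
     fold (\<lambda>e A. if insert e A \<in> \<I> then insert e A else A) (rev (sorted_key_list_of_set w X)) {}"

definition Rel :: "'a set \<Rightarrow> 'a set set \<Rightarrow> ('a \<Rightarrow> real) \<Rightarrow> 'a set \<Rightarrow> 'a set" where
  "Rel S \<I> w Y = {y \<in> S - Y. y \<in> Greedy \<I> w (insert y Y)}"

definition random_subset :: "real \<Rightarrow> 'a set \<Rightarrow> 'a set pmf" where
  "random_subset p S =
     map_pmf (\<lambda>f. {e \<in> S. f e}) (Pi_pmf S False (\<lambda>_. bernoulli_pmf p))"

end

theory Submission
  imports Defs
begin

text \<open>Call \<open>e\<close> relevant for \<open>Y\<close> if it can be added to the greedy solution of the heavier elements of \<open>Y\<close>.
  Relevance does not depend on whether \<open>e \<in> Y\<close>, so a relevant \<open>e\<close> ends up in \<open>Greedy(Y)\<close> with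
  probability \<open>p\<close> and in \<open>Rel(Y)\<close> with probability \<open>1 - p\<close>; the same holds when one additionally asks
  \<open>e\<close> to be blocked by component \<open>j\<close>, i.e. to lie in the hull of the heavier elements of
  \<open>Rel(Y) \<inter> S\<^sub>j\<close>. The core loses exactly the blocked elements of \<open>Rel(Y)\<close>, and their expected weight is
  \<open>(1 - p) / p\<close> times that of the blocked elements of \<open>Greedy(Y)\<close>. These form an independent set inside
  a hull, disjoint from the set spanning it, so the growth property bounds their number above every
  weight threshold by \<open>k\<^sub>j\<close> times the size of \<open>Rel(Y) \<inter> S\<^sub>j\<close>. Abel summation turns these cardinality
  bounds into weights.\<close>

subsection \<open>Weights and upper level sets\<close>

text \<open>Peeling off the lightest element suits every later induction: greedy decides on it last,
  it cannot affect the primitive-core test of the others, and Abel summation ends with it.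
  Injectivity makes the ranking strict.\<close>

lemma finite_inj_weight_induct [consumes 2, case_names empty insert]:
  fixes w :: "'a \<Rightarrow> real"
  assumes "finite X" and "inj_on w X" and "P {}"
    and step: "\<And>x X. \<lbrakk>finite X; inj_on w (insert x X); \<And>y. y \<in> X \<Longrightarrow> w x < w y; P X\<rbrakk>
      \<Longrightarrow> P (insert x X)"
  shows "P X"
proof -
  have "inj_on w X \<longrightarrow> P X"
    using \<open>finite X\<close>
  proof (induction X rule: finite_ranking_induct[where f = "\<lambda>x. - w x"])
    case empty
    then show ?case using \<open>P {}\<close> by simp
  next
    case (insert x X)
    show ?case
    proof (cases "x \<in> X")
      case True
      then show ?thesis using insert by (simp add: insert_absorb)
    next
      case False
      show ?thesis
      proof
        assume inj: "inj_on w (insert x X)"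
        have "w x < w y" if "y \<in> X" for y
          using insert(2)[OF that] inj that False
          by (metis inj_on_contraD insertCI le_neq_trans neg_le_iff_le)
        then show "P (insert x X)"
          using step insert inj by (metis inj_on_insert)
      qed
    qed
  qed
  then show ?thesis using assms by simp
qed

lemma sum_mult_nonneg_if_upper_sums_nonneg:
  fixes w g :: "'a \<Rightarrow> real"
  assumes "finite U" and "inj_on w U" and "\<And>u. u \<in> U \<Longrightarrow> 0 \<le> w u"
    and "\<And>t. 0 \<le> (\<Sum>u\<in>{u\<in>U. w u > t}. g u)"
  shows "0 \<le> (\<Sum>u\<in>U. w u * g u)"
proof -
  \<comment> \<open>Abel summation; the lower bound \<open>m\<close> on the weights makes the induction go through.\<close>
  have "(\<And>t. 0 \<le> (\<Sum>u\<in>{u\<in>U. w u > t}. g u)) \<Longrightarrow> (\<And>u. u \<in> U \<Longrightarrow> m \<le> w u)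
      \<Longrightarrow> m * (\<Sum>u\<in>U. g u) \<le> (\<Sum>u\<in>U. w u * g u)" for m
    using assms(1,2)
  proof (induction U arbitrary: m rule: finite_inj_weight_induct)
    case empty
    then show ?case by simp
  next
    case (insert x X)
    have x: "x \<notin> X" using insert(3) by blast
    \<comment> \<open>Raising the threshold to at least \<open>w x\<close> removes \<open>x\<close>
      and keeps every element of \<open>X\<close> above \<open>t\<close>, so the level sets of
      \<open>X\<close> are among those of \<open>insert x X\<close>.\<close>
    have upper: "0 \<le> (\<Sum>u\<in>{u\<in>X. w u > t}. g u)" for t
    proof -
      have "{u \<in> X. w u > t} = {u \<in> insert x X. w u > max t (w x)}"
        using insert(3) by auto
      then show ?thesis using insert(5)[of "max t (w x)"] by (simp only:)
    qed
    \<comment> \<open>Any threshold below \<open>w x\<close> would do: the level set is then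
      everything, so the full sum is covered by the hypothesis too.\<close>
    have "{u \<in> insert x X. w u > w x - 1} = insert x X"
      using insert(3) by force
    then have total: "0 \<le> (\<Sum>u\<in>insert x X. g u)"
      using insert(5)[of "w x - 1"] by simp
    have "m * (\<Sum>u\<in>insert x X. g u) \<le> w x * (\<Sum>u\<in>insert x X. g u)"
      using total insert(6) by (intro mult_right_mono) auto
    also have "\<dots> = w x * g x + w x * (\<Sum>u\<in>X. g u)"
      using insert(1) x by (simp add: distrib_left)
    also have "\<dots> \<le> w x * g x + (\<Sum>u\<in>X. w u * g u)"
      using insert(4)[OF upper, of "w x"] insert(3) by (simp add: less_imp_le)
    finally show ?case using insert(1) x by simp
  qed
  from this[of 0] show ?thesis using assms(3,4) by simp
qed

text \<open>Abel summation is applied to \<open>c\<close> times the indicator of \<open>B\<close>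
  minus the indicator of \<open>A\<close>; its sum over an upper level set is exactly the slack in
  the cardinality hypothesis.\<close>

lemma sum_le_sum_if_upper_card_le:
  fixes w :: "'a \<Rightarrow> real" and c :: nat
  assumes "finite U" and "inj_on w U" and "\<And>u. u \<in> U \<Longrightarrow> 0 \<le> w u"
    and "A \<subseteq> U" and "B \<subseteq> U"
    and card: "\<And>t. card {a\<in>A. w a > t} \<le> c * card {b\<in>B. w b > t}"
  shows "sum w A \<le> real c * sum w B"
proof -
  let ?g = "\<lambda>u. real c * of_bool (u \<in> B) - of_bool (u \<in> A)"
  have part: "(\<Sum>u\<in>{u\<in>U. P u}. h u * of_bool (u \<in> C)) = (\<Sum>u\<in>{u\<in>C. P u}. h u)"
    if "C \<subseteq> U" for P and h :: "'a \<Rightarrow> real" and C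
    using assms(1) that by (intro sum.mono_neutral_cong_right) auto
  have "0 \<le> (\<Sum>u\<in>{u\<in>U. w u > t}. ?g u)" for t
    using part[OF \<open>A \<subseteq> U\<close>, where P = "\<lambda>u. w u > t" and h = "\<lambda>_. 1"]
      part[OF \<open>B \<subseteq> U\<close>, where P = "\<lambda>u. w u > t" and h = "\<lambda>_. 1"] of_nat_mono[OF card[of t], where 'a = real]
    by (simp add: sum_subtractf sum_distrib_left[symmetric])
  then have "0 \<le> (\<Sum>u\<in>U. w u * ?g u)"
    using sum_mult_nonneg_if_upper_sums_nonneg[OF assms(1-3), of ?g] by simp
  also have "\<dots> = real c * (\<Sum>u\<in>U. w u * of_bool (u \<in> B)) - (\<Sum>u\<in>U. w u * of_bool (u \<in> A))"
    by (simp add: sum_subtractf sum_distrib_left right_diff_distrib mult.left_commute)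
  also have "\<dots> = real c * sum w B - sum w A"
    using part[OF \<open>A \<subseteq> U\<close>, where P = "\<lambda>_. True" and h = w]
      part[OF \<open>B \<subseteq> U\<close>, where P = "\<lambda>_. True" and h = w] by simp
  finally show ?thesis by simp
qed

subsection \<open>The greedy algorithm\<close>

text \<open>Two insertions commute only if their keys differ, and \<open>w\<close> is injective only
  on the ground set. This relativised form yields the recursion equations of
  \<open>sorted_key_list_of_set\<close> for an element type without an order.\<close>

lemma folding_on_insort_key:
  assumes "inj_on f S"
  shows "folding_on S (insort_key f)"
proof
  fix x y assume "x \<in> S" "y \<in> S"
  then show "insort_key f y \<circ> insort_key f x = insort_key f x \<circ> insort_key f y"
    using assms by (cases "x = y") (auto simp: fun_eq_iff inj_on_eq_iff intro: insort_key_left_comm)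
qed

lemma set_sorted_key_list_of_set_inj:
  assumes "finite X" and "inj_on f X"
  shows "set (sorted_key_list_of_set f X) = X"
  using assms
proof (induction X)
  case empty
  show ?case
    using folding_on.empty[OF folding_on_insort_key[OF empty]]
    by (simp add: sorted_key_list_of_set_def)
next
  case (insert x X)
  then show ?case
    using folding_on.insert[OF folding_on_insort_key, of f "insert x X" x X]
    by (simp add: sorted_key_list_of_set_def set_insort_key)
qed

lemma sorted_key_list_of_set_insert_least:
  fixes w :: "'a \<Rightarrow> real"
  assumes "finite X" and "inj_on w (insert x X)" and least: "\<And>y. y \<in> X \<Longrightarrow> w x < w y"
  shows "sorted_key_list_of_set w (insert x X) = x # sorted_key_list_of_set w X"
proof -
  have "x \<notin> X" using least by blast
  then have "sorted_key_list_of_set w (insert x X) = insort_key w x (sorted_key_list_of_set w X)"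
    using folding_on.insert[OF folding_on_insort_key[OF assms(2)] subset_refl assms(1)]
    by (simp add: sorted_key_list_of_set_def)
  moreover have "set (sorted_key_list_of_set w X) = X"
    using assms(1,2) by (intro set_sorted_key_list_of_set_inj) auto
  ultimately show ?thesis
    using least by (simp add: insort_is_Cons less_imp_le)
qed

lemma Greedy_empty [simp]: "Greedy \<I> w {} = {}"
proof -
  have "sorted_key_list_of_set w {} = []"
    using folding_on.empty[OF folding_on_insort_key, of w "{}"]
    by (simp add: sorted_key_list_of_set_def)
  then show ?thesis by (simp add: Greedy_def)
qed

text \<open>After the reversal the lightest element comes last, so it adds a single test to the run
  on the others.\<close>

lemma Greedy_insert_least:
  assumes "finite X" and "inj_on w (insert x X)" and "\<And>y. y \<in> X \<Longrightarrow> w x < w y"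
  shows "Greedy \<I> w (insert x X) =
    (if insert x (Greedy \<I> w X) \<in> \<I> then insert x (Greedy \<I> w X) else Greedy \<I> w X)"
  using sorted_key_list_of_set_insert_least[OF assms] by (simp add: Greedy_def)

lemma Greedy_subset_indep:
  assumes "finite X" and "inj_on w X" and "{} \<in> \<I>"
  shows "Greedy \<I> w X \<subseteq> X \<and> Greedy \<I> w X \<in> \<I>"
  using assms(1,2)
proof (induction X rule: finite_inj_weight_induct)
  case empty
  then show ?case using assms(3) by simp
next
  case (insert x X)
  then show ?case by (auto simp: Greedy_insert_least)
qed

text \<open>The decision about \<open>e\<close> is made when exactly the heavier elements have been
  processed, and it is never revised. From here on this local criterion replaces the list-based
  algorithm.\<close>

lemma mem_Greedy_iff:
  assumes "finite X" and "inj_on w X" and "{} \<in> \<I>"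
  shows "e \<in> Greedy \<I> w X \<longleftrightarrow> e \<in> X \<and> insert e (Greedy \<I> w {f\<in>X. w f > w e}) \<in> \<I>"
  using assms(1,2)
proof (induction X rule: finite_inj_weight_induct)
  case empty
  then show ?case by simp
next
  case (insert x X)
  have x: "x \<notin> X" using insert(3) by blast
  have sub: "Greedy \<I> w X \<subseteq> X"
    using Greedy_subset_indep[of X w \<I>] insert(1,2) assms(3) by simp
  show ?case
  proof (cases "e = x")
    case True
    have "{f \<in> insert x X. w f > w x} = X" using insert(3) by auto
    then show ?thesis using True x sub insert by (auto simp: Greedy_insert_least)
  next
    case False
    have "{f \<in> insert x X. w f > w e} = {f \<in> X. w f > w e}" if "e \<in> X"
      using insert(3)[OF that] by auto
    then show ?thesis using False sub insert by (auto simp: Greedy_insert_least)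
  qed
qed

subsection \<open>Hulls in growth systems and matroids\<close>

lemma indep_system_finite: "indep_system S \<I> \<Longrightarrow> finite S"
  by (simp add: indep_system_def)

lemma indep_system_subset:
  assumes "indep_system S \<I>" and "A \<in> \<I>" and "B \<subseteq> A"
  shows "B \<in> \<I>"
proof -
  have "\<forall>A B. A \<in> \<I> \<and> B \<subseteq> A \<longrightarrow> B \<in> \<I>"
    using assms(1) unfolding indep_system_def by (elim conjE)
  then show ?thesis using assms(2,3) by simp
qed

lemma circuit_minus_indep:
  assumes "circuit S \<I> C" and "e \<in> C"
  shows "C - {e} \<in> \<I>"
proof -
  have "C - {e} \<subset> C" using assms(2) by auto
  then show ?thesis using assms(1) by (simp add: circuit_def)
qed

lemma circuit_dependent: "circuit S \<I> C \<Longrightarrow> C \<notin> \<I>"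
  by (simp add: circuit_def)

lemma circuit_in_dependent:
  assumes "finite D" and "D \<subseteq> S" and "D \<notin> \<I>"
  obtains C where "circuit S \<I> C" and "C \<subseteq> D"
proof -
  have "\<exists>C\<subseteq>D. circuit S \<I> C"
    using assms
  proof (induction D rule: finite_psubset_induct)
    case (psubset D)
    show ?case
    proof (cases "\<forall>E. E \<subset> D \<longrightarrow> E \<in> \<I>")
      case True
      then show ?thesis using psubset unfolding circuit_def by blast
    next
      case False
      then obtain E where "E \<subset> D" "E \<notin> \<I>" by blast
      then show ?thesis using psubset by (meson order_trans psubset_imp_subset)
    qed
  qed
  then show thesis using that by blast
qed

lemma basis_of_subset: "basis_of \<I> X P \<Longrightarrow> P \<subseteq> X"
  by (simp add: basis_of_def)

lemma basis_of_indep: "basis_of \<I> X P \<Longrightarrow> P \<in> \<I>"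
  by (simp add: basis_of_def)

lemma basis_of_maximal:
  assumes "basis_of \<I> X P" and "e \<in> X" and "insert e P \<in> \<I>"
  shows "e \<in> P"
proof (rule ccontr)
  assume "e \<notin> P"
  then have "P \<subset> insert e P" "insert e P \<subseteq> X" using assms(2) basis_of_subset[OF assms(1)] by auto
  then show False using assms(1,3) unfolding basis_of_def by metis
qed

lemma basis_ofI:
  assumes sys: "indep_system S \<I>" and "P \<subseteq> X" and "P \<in> \<I>"
    and max: "\<And>e. e \<in> X \<Longrightarrow> e \<notin> P \<Longrightarrow> insert e P \<notin> \<I>"
  shows "basis_of \<I> X P"
proof -
  have "P' \<notin> \<I>" if P': "P \<subset> P'" "P' \<subseteq> X" for P'
  proof
    assume "P' \<in> \<I>"
    obtain e where e: "e \<in> P'" "e \<notin> P" using P'(1) by blast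
    then have "insert e P \<subseteq> P'" using P'(1) by blast
    then have "insert e P \<in> \<I>" by (rule indep_system_subset[OF sys \<open>P' \<in> \<I>\<close>])
    then show False using max e P'(2) by blast
  qed
  then show ?thesis using assms(2,3) unfolding basis_of_def by simp
qed

lemma ex_basis_of_superset:
  assumes "finite X" and "A \<subseteq> X" and "A \<in> \<I>"
  obtains P where "A \<subseteq> P" and "basis_of \<I> X P"
proof -
  let ?F = "{P. P \<subseteq> X \<and> P \<in> \<I> \<and> A \<subseteq> P}"
  have F: "finite ?F" "A \<in> ?F" using assms by simp_all
  from finite_has_maximal2[OF F]
  obtain P where P: "P \<in> ?F" and max: "\<forall>P'\<in>?F. P \<subseteq> P' \<longrightarrow> P = P'"
    by (elim bexE conjE)
  have "P' \<notin> \<I>" if "P \<subset> P'" "P' \<subseteq> X" for P'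
    using P max that by blast
  then have "basis_of \<I> X P" using P unfolding basis_of_def by blast
  then show thesis using that P by blast
qed

lemma PHullE:
  assumes "e \<in> PHull S \<I> X" and "e \<notin> X"
  obtains C where "circuit S \<I> C" and "e \<in> C" and "C \<subseteq> insert e X"
proof -
  have "\<exists>C. circuit S \<I> C \<and> e \<in> C \<and> C \<subseteq> insert e X"
    using assms unfolding PHull_def by simp
  then show thesis using that by (elim exE conjE)
qed

lemma PHull_mono:
  assumes "X \<subseteq> Y"
  shows "PHull S \<I> X \<subseteq> PHull S \<I> Y"
proof
  fix e assume e: "e \<in> PHull S \<I> X"
  show "e \<in> PHull S \<I> Y"
  proof (cases "e \<in> X")
    case True
    then show ?thesis using assms by (auto simp: PHull_def)
  next
    case False
    obtain C where C: "circuit S \<I> C" "e \<in> C" "C \<subseteq> insert e X"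
      using PHullE[OF e False] by metis
    have "C \<subseteq> insert e Y" using C(3) assms by auto
    moreover have "e \<in> S" using e False by (simp add: PHull_def)
    ultimately show ?thesis using C by (auto simp: PHull_def)
  qed
qed

text \<open>A circuit inside \<open>insert e B\<close> must use \<open>e\<close>, since
  \<open>B\<close> alone is independent.\<close>

lemma mem_PHull_if_dependent:
  assumes "indep_system S \<I>" and "X \<subseteq> S" and "e \<in> S" and "B \<subseteq> X"
    and "B \<in> \<I>" and "insert e B \<notin> \<I>"
  shows "e \<in> PHull S \<I> X"
proof -
  have "finite S" using assms(1) by (rule indep_system_finite)
  then have "finite (insert e B)" "insert e B \<subseteq> S"
    using assms by (auto intro: finite_subset)
  then obtain C where C: "circuit S \<I> C" "C \<subseteq> insert e B"
    using circuit_in_dependent assms(6) by metis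
  have "e \<in> C"
  proof (rule ccontr)
    assume "e \<notin> C"
    then have "C \<subseteq> B" using C(2) by blast
    then have "C \<in> \<I>" by (rule indep_system_subset[OF assms(1,5)])
    then show False using circuit_dependent[OF C(1)] by simp
  qed
  then show ?thesis using C assms(3,4) unfolding PHull_def by blast
qed

text \<open>If \<open>e \<in> Q\<close> lay in the hull of \<open>X\<close>, a basis of \<open>X\<close> extending the rest of its circuit would
  make \<open>P \<union> Q\<close> dependent. Hence only \<open>Z\<close> can meet the hull.\<close>

lemma growth_system_card_hull_le:
  assumes growth: "growth_system k S \<I>" and "X \<subseteq> S" and "I \<in> \<I>"
    and "D \<subseteq> I" and "D \<inter> X = {}" and "D \<subseteq> PHull S \<I> X"
  shows "card D \<le> k * card X"
proof -
  have sys: "indep_system S \<I>" using growth by (simp add: growth_system_def)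
  then have finS: "finite S" by (rule indep_system_finite)
  obtain Q Z where QZ: "Q \<union> Z = I - X" "Q \<inter> Z = {}" "card Z \<le> k * card (X - I)"
    and grow: "\<And>P. basis_of \<I> X P \<Longrightarrow> P \<union> Q \<in> \<I>"
    using growth \<open>X \<subseteq> S\<close> \<open>I \<in> \<I>\<close> unfolding growth_system_def by metis
  have "D \<subseteq> Z"
  proof
    fix e assume "e \<in> D"
    then have e: "e \<notin> X" "e \<in> PHull S \<I> X" using assms by auto
    then obtain C where C: "circuit S \<I> C" "e \<in> C" "C \<subseteq> insert e X"
      using PHullE[OF e(2,1)] by metis
    have "C - {e} \<in> \<I>" using C by (blast intro: circuit_minus_indep)
    moreover have "C - {e} \<subseteq> X" using C(3) by blast
    ultimately obtain P where P: "C - {e} \<subseteq> P" "basis_of \<I> X P"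
      using ex_basis_of_superset[OF finite_subset[OF \<open>X \<subseteq> S\<close> finS]] by metis
    have "e \<notin> Q"
    proof
      assume "e \<in> Q"
      then have "C \<subseteq> P \<union> Q" using P by blast
      then have "C \<in> \<I>" by (rule indep_system_subset[OF sys grow[OF P(2)]])
      then show False using circuit_dependent[OF C(1)] by simp
    qed
    then show "e \<in> Z" using QZ \<open>e \<in> D\<close> e assms by blast
  qed
  moreover have "finite Z"
  proof (rule finite_subset[OF _ finS])
    have "I \<subseteq> S" using sys \<open>I \<in> \<I>\<close> unfolding indep_system_def by blast
    then show "Z \<subseteq> S" using QZ(1) by blast
  qed
  ultimately have "card D \<le> card Z" by (rule card_mono[rotated])
  also have "\<dots> \<le> k * card (X - I)" by (rule QZ)
  also have "\<dots> \<le> k * card X"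
    using finS \<open>X \<subseteq> S\<close> by (intro mult_le_mono2 card_mono) (auto intro: finite_subset)
  finally show ?thesis .
qed

section \<open>Matroids: bases, hulls and the primitive core\<close>

lemma matroid_augment:
  assumes "matroid S \<I>" and "A \<in> \<I>" and "B \<in> \<I>" and "card A < card B"
  obtains e where "e \<in> B" and "e \<notin> A" and "insert e A \<in> \<I>"
proof -
  from assms(1) have "\<forall>A\<in>\<I>. \<forall>B\<in>\<I>. card A < card B \<longrightarrow> (\<exists>e\<in>B - A. insert e A \<in> \<I>)"
    unfolding matroid_def by (rule conjunct2)
  note this[rule_format, OF assms(2-4)]
  then show thesis by (elim bexE DiffE) (rule that)
qed

lemma matroid_basis_card_eq:
  assumes "matroid S \<I>" and "basis_of \<I> X P" and "basis_of \<I> X Q"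
  shows "card P = card Q"
proof -
  have "card B \<le> card A" if AB: "basis_of \<I> X A" "basis_of \<I> X B" for A B
  proof (rule ccontr)
    assume "\<not> ?thesis"
    then obtain e where "e \<in> B" "e \<notin> A" "insert e A \<in> \<I>"
      using matroid_augment[OF assms(1) AB[THEN basis_of_indep]] by (metis not_le)
    then show False using basis_of_maximal[OF AB(1)] basis_of_subset[OF AB(2)] by blast
  qed
  then show ?thesis using assms by (simp add: le_antisym)
qed

text \<open>In a matroid an element of the hull is rejected by every basis, not only by those
  containing the rest of its circuit. Adding \<open>e\<close> does not raise the rank of
  \<open>X\<close>: a basis of \<open>insert e X\<close> extending \<open>C - {e}\<close> must avoid
  \<open>e\<close>. An independent \<open>insert e B\<close> would exceed that rank.\<close>

lemma matroid_insert_basis_dependent: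
  assumes mat: "matroid S \<I>" and "X \<subseteq> S" and basis: "basis_of \<I> X B"
    and "e \<in> PHull S \<I> X" and "e \<notin> X"
  shows "insert e B \<notin> \<I>"
proof
  assume indep: "insert e B \<in> \<I>"
  have sys: "indep_system S \<I>" using mat by (simp add: matroid_def)
  then have fin: "finite X"
    by (rule finite_subset[OF \<open>X \<subseteq> S\<close> indep_system_finite])
  obtain C where C: "circuit S \<I> C" "e \<in> C" "C \<subseteq> insert e X"
    using PHullE[OF assms(4,5)] by metis
  have "C - {e} \<in> \<I>" using C by (blast intro: circuit_minus_indep)
  moreover have "C - {e} \<subseteq> insert e X" using C(3) by blast
  ultimately obtain P where P: "C - {e} \<subseteq> P" "basis_of \<I> (insert e X) P"
    using ex_basis_of_superset[of "insert e X"] fin by (metis finite_insert)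
  have "e \<notin> P"
  proof
    assume "e \<in> P"
    then have "C \<subseteq> P" using P by blast
    then have "C \<in> \<I>" by (rule indep_system_subset[OF sys basis_of_indep[OF P(2)]])
    then show False using circuit_dependent[OF C(1)] by simp
  qed
  \<comment> \<open>Since \<open>P\<close> avoids \<open>e\<close>, it is a basis of both
    \<open>X\<close> and \<open>insert e X\<close>, which ties the two ranks together.\<close>
  then have PX: "basis_of \<I> X P" using P unfolding basis_of_def by blast
  have "insert e B \<subseteq> insert e X" using basis_of_subset[OF basis] by blast
  then obtain B' where B': "insert e B \<subseteq> B'" "basis_of \<I> (insert e X) B'"
    using ex_basis_of_superset[OF _ _ indep, of "insert e X"] fin by (metis finite_insert)
  have "finite B'" using basis_of_subset[OF B'(2)] fin by (auto intro: finite_subset)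
  moreover have "finite B" "e \<notin> B"
    using basis_of_subset[OF basis] fin assms(5) by (auto intro: finite_subset)
  ultimately have "card B < card B'" using card_mono[OF _ B'(1)] by simp
  also have "card B' = card P" using matroid_basis_card_eq[OF mat B'(2) P(2)] .
  also have "\<dots> = card B" using matroid_basis_card_eq[OF mat PX basis] .
  finally show False by simp
qed

lemma PCore_subset: "PCore S \<I> w X \<subseteq> X"
  by (auto simp: PCore_def)

text \<open>Whether \<open>e\<close> survives depends only on elements heavier than
  \<open>e\<close>, all of which pass any threshold that \<open>e\<close> passes. Thus the basis
  property below can be used at each weight level separately.\<close>

lemma PCore_upper:
  "{e \<in> PCore S \<I> w X. w e > t} = PCore S \<I> w {e \<in> X. w e > t}"
proof -
  have "{f \<in> {e \<in> X. w e > t}. w f > w e} = {f \<in> X. w f > w e}" if "w e > t" for e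
    using that by auto
  then show ?thesis unfolding PCore_def by auto
qed

text \<open>For a matroid the primitive core is what greedy would select: the lightest
  \<open>x\<close> leaves the other memberships unchanged and joins iff it lies outside the hull of
  \<open>X\<close>, which is precisely when the current basis can be extended by
  \<open>x\<close>.\<close>

lemma matroid_PCore_basis:
  assumes mat: "matroid S \<I>" and "X \<subseteq> S" and "inj_on w X"
  shows "basis_of \<I> X (PCore S \<I> w X)"
proof -
  have sys: "indep_system S \<I>" using mat by (simp add: matroid_def)
  then have "finite X"
    by (rule finite_subset[OF \<open>X \<subseteq> S\<close> indep_system_finite])
  then show ?thesis using \<open>inj_on w X\<close> \<open>X \<subseteq> S\<close>
  proof (induction X rule: finite_inj_weight_induct)
    case empty
    then show ?case using sys by (auto simp: PCore_def basis_of_def indep_system_def)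
  next
    case (insert x X)
    have x: "x \<notin> X" using insert(3) by blast
    let ?B = "PCore S \<I> w X"
    have B: "basis_of \<I> X ?B" using insert by simp
    have above: "{f \<in> insert x X. w f > w e} = {f \<in> X. w f > w e}" if "e \<in> X" for e
      using insert(3)[OF that] by auto
    have top: "{f \<in> insert x X. w f > w x} = X" using insert(3) by auto
    have mem: "e \<in> PCore S \<I> w (insert x X) \<longleftrightarrow>
        e \<in> ?B \<or> e = x \<and> x \<notin> PHull S \<I> X" for e
    proof (cases "e = x")
      case True
      have "x \<notin> ?B" using PCore_subset[of S \<I> w X] x by auto
      then show ?thesis using x unfolding True PCore_def mem_Collect_eq top by simp
    next
      case False
      show ?thesis
      proof (cases "e \<in> X")
        case True
        then show ?thesis using False unfolding PCore_def mem_Collect_eq above[OF True] by simp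
      next
        assume "e \<notin> X"
        then have "e \<notin> ?B" using PCore_subset[of S \<I> w X] by auto
        moreover have "e \<notin> PCore S \<I> w (insert x X)"
          using PCore_subset[of S \<I> w "insert x X"] False \<open>e \<notin> X\<close> by auto
        ultimately show ?thesis using False by simp
      qed
    qed
    show ?case
    proof (cases "x \<in> PHull S \<I> X")
      case True
      have "insert x ?B \<notin> \<I>"
        using matroid_insert_basis_dependent[OF mat _ B True x] insert(5) by simp
      then have "basis_of \<I> (insert x X) ?B"
        using basis_of_subset[OF B] basis_of_indep[OF B] basis_of_maximal[OF B]
        by (intro basis_ofI[OF sys]) auto
      moreover have "PCore S \<I> w (insert x X) = ?B" using mem True by auto
      ultimately show ?thesis by simp
    next
      case False
      have "insert x ?B \<in> \<I>"
        using mem_PHull_if_dependent[OF sys, of X x ?B] False insert(5)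
          basis_of_subset[OF B] basis_of_indep[OF B] by auto
      moreover have "insert e (insert x ?B) \<notin> \<I>" if "e \<in> insert x X" "e \<notin> insert x ?B" for e
      proof
        assume "insert e (insert x ?B) \<in> \<I>"
        then have "insert e ?B \<in> \<I>" by (rule indep_system_subset[OF sys]) blast
        then show False using basis_of_maximal[OF B] that by blast
      qed
      ultimately have "basis_of \<I> (insert x X) (insert x ?B)"
        using basis_of_subset[OF B] by (intro basis_ofI[OF sys]) auto
      moreover have "PCore S \<I> w (insert x X) = insert x ?B" using mem False by auto
      ultimately show ?thesis by simp
    qed
  qed
qed

text \<open>Sharper than the growth bound with constant 1: the size of \<open>X\<close> is replaced
  by its rank. Otherwise augmentation would extend \<open>B\<close> by an element of the
  hull.\<close>

lemma matroid_card_hull_le: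
  assumes mat: "matroid S \<I>" and "X \<subseteq> S" and B: "basis_of \<I> X B"
    and D: "D \<in> \<I>" "D \<inter> X = {}" "D \<subseteq> PHull S \<I> X"
  shows "card D \<le> card B"
proof (rule ccontr)
  assume "\<not> ?thesis"
  then obtain e where "e \<in> D" "insert e B \<in> \<I>"
    using matroid_augment[OF mat basis_of_indep[OF B] D(1)] by (metis not_le)
  then show False using matroid_insert_basis_dependent[OF mat \<open>X \<subseteq> S\<close> B, of e] D by blast
qed

subsection \<open>Random subsets\<close>

lemma finite_set_random_subset:
  assumes "finite T"
  shows "finite (set_pmf (random_subset p T))"
  by (rule finite_subset[of _ "Pow T"]) (auto simp: random_subset_def assms)

lemma integrable_random_subset [simp]:
  fixes f :: "'a set \<Rightarrow> real"
  assumes "finite T"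
  shows "integrable (measure_pmf (random_subset p T)) f"
  by (rule integrable_measure_pmf_finite) (rule finite_set_random_subset[OF assms])

lemma random_subset_subset: "Y \<in> set_pmf (random_subset p T) \<Longrightarrow> Y \<subseteq> T"
  by (auto simp: random_subset_def)

lemma random_subset_insert:
  assumes "finite T" and "e \<notin> T"
  shows "random_subset p (insert e T) = bernoulli_pmf p \<bind>
    (\<lambda>b. map_pmf (\<lambda>Y. if b then insert e Y else Y) (random_subset p T))"
proof -
  have eq: "{x. (x = e \<or> x \<in> T) \<and> (if x = e then b else f x)} =
      (if b then insert e {x \<in> T. f x} else {x \<in> T. f x})" for b f
    using assms(2) by auto
  show ?thesis
    unfolding random_subset_def using assms
    by (simp add: Pi_pmf_insert' map_bind_pmf map_pmf_comp o_def fun_upd_def eq)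
       (simp add: map_pmf_def bind_assoc_pmf bind_return_pmf)
qed

lemma expectation_random_subset_insert:
  fixes f :: "'a set \<Rightarrow> real"
  assumes "finite T" and "e \<notin> T" and "0 \<le> p" and "p \<le> 1"
  shows "measure_pmf.expectation (random_subset p (insert e T)) f =
    p * measure_pmf.expectation (random_subset p T) (\<lambda>Y. f (insert e Y)) +
    (1 - p) * measure_pmf.expectation (random_subset p T) f"
proof -
  have "measure_pmf.expectation (random_subset p (insert e T)) f =
    measure_pmf.expectation (bernoulli_pmf p) (\<lambda>b. measure_pmf.expectation (random_subset p T) (\<lambda>Y. f (if b then insert e Y else Y)))"
    unfolding random_subset_insert[OF assms(1,2)]
    by (subst pmf_expectation_bind[of UNIV])
       (auto simp: assms finite_set_random_subset integral_measure_pmf[of UNIV])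
  then show ?thesis using assms by simp
qed

lemma expectation_random_subset_cong:
  fixes f g :: "'a set \<Rightarrow> real"
  assumes "\<And>Y. Y \<subseteq> T \<Longrightarrow> f Y = g Y"
  shows "measure_pmf.expectation (random_subset p T) f = measure_pmf.expectation (random_subset p T) g"
  by (rule integral_cong_AE) (auto simp: AE_measure_pmf_iff assms dest: random_subset_subset)

lemma expectation_random_subset_mono:
  fixes f g :: "'a set \<Rightarrow> real"
  assumes "finite T" and "\<And>Y. Y \<subseteq> T \<Longrightarrow> f Y \<le> g Y"
  shows "measure_pmf.expectation (random_subset p T) f \<le> measure_pmf.expectation (random_subset p T) g"
  by (rule integral_mono_AE) (auto simp: AE_measure_pmf_iff assms dest: random_subset_subset)

text \<open>The event \<open>A\<close> ignores the coin of \<open>e\<close>. Conditioning on all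
  other coins, both sides become p(1 - p) times the probability of \<open>A\<close>.\<close>

lemma expectation_coin_swap:
  fixes T :: "'a set" and A :: "'a set \<Rightarrow> bool"
  assumes "finite T" and "e \<in> T" and "0 \<le> p" and "p \<le> 1"
    and A: "\<And>Y. Y \<subseteq> T - {e} \<Longrightarrow> A (insert e Y) \<longleftrightarrow> A Y"
  shows "p * measure_pmf.expectation (random_subset p T) (\<lambda>Y. of_bool (e \<notin> Y \<and> A Y)) =
    (1 - p) * measure_pmf.expectation (random_subset p T) (\<lambda>Y. of_bool (e \<in> Y \<and> A Y))"
proof -
  define E :: "('a set \<Rightarrow> real) \<Rightarrow> real" where "E = measure_pmf.expectation (random_subset p (T - {e}))"
  have split: "measure_pmf.expectation (random_subset p T) f =
      p * E (\<lambda>Y. f (insert e Y)) + (1 - p) * E f" for f :: "'a set \<Rightarrow> real"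
    using expectation_random_subset_insert[of "T - {e}" e p f] assms(1-4)
    by (simp add: E_def insert_absorb)
  have "E (\<lambda>Y. of_bool (e \<notin> insert e Y \<and> A (insert e Y))) = 0"
    by (simp add: E_def)
  moreover have "E (\<lambda>Y. of_bool (e \<notin> Y \<and> A Y)) = E (\<lambda>Y. of_bool (A Y))"
    unfolding E_def by (rule expectation_random_subset_cong) auto
  moreover have "E (\<lambda>Y. of_bool (e \<in> insert e Y \<and> A (insert e Y))) = E (\<lambda>Y. of_bool (A Y))"
    unfolding E_def by (rule expectation_random_subset_cong) (simp add: A)
  moreover have "E (\<lambda>Y. of_bool (e \<in> Y \<and> A Y)) = E (\<lambda>Y. 0)"
    unfolding E_def by (rule expectation_random_subset_cong) auto
  moreover have "E (\<lambda>Y. 0) = 0" by (simp add: E_def)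
  ultimately show ?thesis by (simp only: split) simp
qed

lemma expectation_sum_coin_swap:
  fixes w :: "'a \<Rightarrow> real"
  assumes "finite T" and "0 \<le> p" and "p \<le> 1"
    and A: "\<And>e Y. e \<in> T \<Longrightarrow> Y \<subseteq> T - {e} \<Longrightarrow> A e (insert e Y) \<longleftrightarrow> A e Y"
  shows "p * measure_pmf.expectation (random_subset p T) (\<lambda>Y. sum w {e\<in>T. e \<notin> Y \<and> A e Y}) =
    (1 - p) * measure_pmf.expectation (random_subset p T) (\<lambda>Y. sum w {e\<in>T. e \<in> Y \<and> A e Y})"
proof -
  let ?E = "measure_pmf.expectation (random_subset p T)"
  have lin: "?E (\<lambda>Y. sum w {e\<in>T. P e Y}) = (\<Sum>e\<in>T. w e * ?E (\<lambda>Y. of_bool (P e Y)))" for P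
  proof -
    have "sum w {e\<in>T. P e Y} = (\<Sum>e\<in>T. w e * of_bool (P e Y))" for Y
      using assms(1) by (intro sum.mono_neutral_cong_left) auto
    then have "?E (\<lambda>Y. sum w {e\<in>T. P e Y}) = ?E (\<lambda>Y. \<Sum>e\<in>T. w e * of_bool (P e Y))"
      by (simp only:)
    also have "\<dots> = (\<Sum>e\<in>T. ?E (\<lambda>Y. w e * of_bool (P e Y)))"
      by (rule Bochner_Integration.integral_sum) (simp add: assms(1))
    finally show ?thesis by simp
  qed
  have "p * ?E (\<lambda>Y. sum w {e\<in>T. e \<notin> Y \<and> A e Y}) =
      (\<Sum>e\<in>T. w e * (p * ?E (\<lambda>Y. of_bool (e \<notin> Y \<and> A e Y))))"
    by (simp only: lin sum_distrib_left mult.left_commute)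
  also have "\<dots> = (\<Sum>e\<in>T. w e * ((1 - p) * ?E (\<lambda>Y. of_bool (e \<in> Y \<and> A e Y))))"
  proof (rule sum.cong[OF refl])
    fix e assume e: "e \<in> T"
    show "w e * (p * ?E (\<lambda>Y. of_bool (e \<notin> Y \<and> A e Y))) =
        w e * ((1 - p) * ?E (\<lambda>Y. of_bool (e \<in> Y \<and> A e Y)))"
      using expectation_coin_swap[OF assms(1) e assms(2,3), of "A e"] A[OF e] by simp
  qed
  also have "\<dots> = (1 - p) * ?E (\<lambda>Y. sum w {e\<in>T. e \<in> Y \<and> A e Y})"
    by (simp only: lin sum_distrib_left mult.left_commute)
  finally show ?thesis .
qed

subsection \<open>Relevant and blocked elements\<close>

locale weighted_indep =
  fixes T :: "'a set" and \<J> :: "'a set set" and w :: "'a \<Rightarrow> real"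
  assumes finite_ground: "finite T"
    and empty_indep: "{} \<in> \<J>"
    and inj_weight: "inj_on w T"
    and weight_nonneg: "e \<in> T \<Longrightarrow> 0 \<le> w e"
begin

definition relevant :: "'a \<Rightarrow> 'a set \<Rightarrow> bool" where
  "relevant e Y \<longleftrightarrow> insert e (Greedy \<J> w {f\<in>Y. w f > w e}) \<in> \<J>"

definition blocked :: "'a set \<Rightarrow> 'a set set \<Rightarrow> 'a set \<Rightarrow> 'a set" where
  "blocked S \<I> Y = {e\<in>S. e \<in> PHull S \<I> {f\<in>Rel T \<J> w Y \<inter> S. w f > w e}}"

lemma finite_sub: "Y \<subseteq> T \<Longrightarrow> finite Y"
  using finite_ground by (rule finite_subset[rotated])

lemma inj_sub: "Y \<subseteq> T \<Longrightarrow> inj_on w Y"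
  using inj_weight by (rule inj_on_subset)

lemma Greedy_sub: "Y \<subseteq> T \<Longrightarrow> Greedy \<J> w Y \<subseteq> Y"
  and Greedy_indep: "Y \<subseteq> T \<Longrightarrow> Greedy \<J> w Y \<in> \<J>"
  using Greedy_subset_indep[OF finite_sub inj_sub empty_indep, of Y] by simp_all

lemma Rel_sub: "Rel T \<J> w Y \<subseteq> T - Y"
  by (auto simp: Rel_def)

lemma mem_Greedy: "Y \<subseteq> T \<Longrightarrow> e \<in> Greedy \<J> w Y \<longleftrightarrow> e \<in> Y \<and> relevant e Y"
  unfolding relevant_def by (rule mem_Greedy_iff[OF finite_sub inj_sub empty_indep])

lemma relevant_insert:
  assumes "w e \<le> w f"
  shows "relevant f (insert e Y) \<longleftrightarrow> relevant f Y"
proof -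
  have "{g\<in>insert e Y. w g > w f} = {g\<in>Y. w g > w f}" using assms by auto
  then show ?thesis by (simp add: relevant_def)
qed

lemma mem_Rel:
  assumes "Y \<subseteq> T"
  shows "e \<in> Rel T \<J> w Y \<longleftrightarrow> e \<in> T \<and> e \<notin> Y \<and> relevant e Y"
  using mem_Greedy[of "insert e Y" e] relevant_insert[of e e Y] assms by (auto simp: Rel_def)

text \<open>Inserting \<open>e\<close> can only take \<open>e\<close> itself out of
  \<open>Rel\<close> or change the relevance of lighter elements; the strict threshold hides both.
  Hence being blocked is independent of the element's own coin.\<close>

lemma Rel_insert_upper:
  assumes "e \<in> T" and "Y \<subseteq> T"
  shows "{f\<in>Rel T \<J> w (insert e Y) \<inter> S. w f > w e} = {f\<in>Rel T \<J> w Y \<inter> S. w f > w e}"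
  using assms mem_Rel[of "insert e Y"] mem_Rel[of Y] relevant_insert[of e] by auto

lemma blocked_insert:
  assumes "e \<in> T" and "Y \<subseteq> T"
  shows "e \<in> blocked S \<I> (insert e Y) \<longleftrightarrow> e \<in> blocked S \<I> Y"
  by (simp only: blocked_def mem_Collect_eq Rel_insert_upper[OF assms])

text \<open>The parameter \<open>B\<close> serves two uses: \<open>UNIV\<close> compares the total
  weights of \<open>Rel\<close> and \<open>Greedy\<close>, and a blocked set compares their blocked
  parts.\<close>

lemma expectation_Rel_Greedy_inter:
  assumes "0 \<le> p" and "p \<le> 1"
    and B: "\<And>e Y. e \<in> T \<Longrightarrow> Y \<subseteq> T \<Longrightarrow> e \<in> B (insert e Y) \<longleftrightarrow> e \<in> B Y"
  shows "p * measure_pmf.expectation (random_subset p T) (\<lambda>Y. sum w (Rel T \<J> w Y \<inter> B Y)) =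
    (1 - p) * measure_pmf.expectation (random_subset p T) (\<lambda>Y. sum w (Greedy \<J> w Y \<inter> B Y))"
proof -
  let ?A = "\<lambda>e Y. relevant e Y \<and> e \<in> B Y"
  have "{e\<in>T. e \<notin> Y \<and> ?A e Y} = Rel T \<J> w Y \<inter> B Y" if "Y \<subseteq> T" for Y
    using mem_Rel[OF that] by auto
  then have rel: "measure_pmf.expectation (random_subset p T) (\<lambda>Y. sum w (Rel T \<J> w Y \<inter> B Y)) =
      measure_pmf.expectation (random_subset p T) (\<lambda>Y. sum w {e\<in>T. e \<notin> Y \<and> ?A e Y})"
    by (intro expectation_random_subset_cong) simp
  have "{e\<in>T. e \<in> Y \<and> ?A e Y} = Greedy \<J> w Y \<inter> B Y" if "Y \<subseteq> T" for Y
    using mem_Greedy[OF that] that by auto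
  then have greedy: "measure_pmf.expectation (random_subset p T) (\<lambda>Y. sum w (Greedy \<J> w Y \<inter> B Y)) =
      measure_pmf.expectation (random_subset p T) (\<lambda>Y. sum w {e\<in>T. e \<in> Y \<and> ?A e Y})"
    by (intro expectation_random_subset_cong) simp
  show ?thesis unfolding rel greedy
  proof (rule expectation_sum_coin_swap[OF finite_ground assms(1,2)])
    fix e Y assume "e \<in> T" "Y \<subseteq> T - {e}"
    then show "?A e (insert e Y) \<longleftrightarrow> ?A e Y"
      using relevant_insert[of e e Y] B[of e Y] by auto
  qed
qed

text \<open>These are the side conditions of both cardinality bounds at level \<open>t\<close>.
  Whatever blocks \<open>e\<close> is heavier than \<open>e\<close> and so also above
  \<open>t\<close>; greedy picks lie inside \<open>Y\<close>, elements of \<open>Rel\<close>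
  outside.\<close>

lemma upper_blocked_Greedy:
  fixes S :: "'a set" and \<I> :: "'a set set"
  assumes "Y \<subseteq> T"
  defines "D \<equiv> \<lambda>t. {e\<in>Greedy \<J> w Y \<inter> blocked S \<I> Y. w e > t}"
    and "X \<equiv> \<lambda>t. {f\<in>Rel T \<J> w Y \<inter> S. w f > t}"
  shows "D t \<subseteq> Greedy \<J> w Y \<inter> S" and "D t \<inter> X t = {}" and "D t \<subseteq> PHull S \<I> (X t)"
proof -
  show "D t \<subseteq> Greedy \<J> w Y \<inter> S" by (auto simp: D_def blocked_def)
  show "D t \<inter> X t = {}"
    using Greedy_sub[OF assms(1)] Rel_sub[of Y] by (auto simp: D_def X_def)
  show "D t \<subseteq> PHull S \<I> (X t)"
  proof
    fix e assume e: "e \<in> D t"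
    then have "{f\<in>Rel T \<J> w Y \<inter> S. w f > w e} \<subseteq> X t" by (auto simp: D_def X_def)
    from PHull_mono[OF this, of S \<I>] show "e \<in> PHull S \<I> (X t)"
      using e by (auto simp: D_def blocked_def)
  qed
qed

lemma sum_Greedy_blocked_le:
  assumes "growth_system k S \<I>" and "\<And>I. I \<in> \<J> \<Longrightarrow> I \<inter> S \<in> \<I>" and Y: "Y \<subseteq> T"
  shows "sum w (Greedy \<J> w Y \<inter> blocked S \<I> Y) \<le> real k * sum w (Rel T \<J> w Y \<inter> S)"
proof (rule sum_le_sum_if_upper_card_le[OF finite_ground inj_weight weight_nonneg])
  show "Greedy \<J> w Y \<inter> blocked S \<I> Y \<subseteq> T" using Greedy_sub[OF Y] Y by auto
  show "Rel T \<J> w Y \<inter> S \<subseteq> T" using Rel_sub[of Y] by auto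
  fix t
  show "card {a\<in>Greedy \<J> w Y \<inter> blocked S \<I> Y. w a > t} \<le> k * card {b\<in>Rel T \<J> w Y \<inter> S. w b > t}"
    by (rule growth_system_card_hull_le[OF assms(1) _ assms(2)[OF Greedy_indep[OF Y]]
          upper_blocked_Greedy[OF Y]]) auto
qed

text \<open>In a matroid, blocked elements do not raise the rank of the relevant elements, so only the
  unblocked ones have to pay for the blocked elements chosen by the greedy algorithm.\<close>

lemma sum_Greedy_blocked_le_matroid:
  assumes mat: "matroid S \<I>" and "\<And>I. I \<in> \<J> \<Longrightarrow> I \<inter> S \<in> \<I>" and Y: "Y \<subseteq> T"
  shows "sum w (Greedy \<J> w Y \<inter> blocked S \<I> Y) \<le>
    sum w (Rel T \<J> w Y \<inter> S) - sum w (Rel T \<J> w Y \<inter> blocked S \<I> Y)"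
proof -
  let ?R = "Rel T \<J> w Y \<inter> S"
  have RT: "?R \<subseteq> T" using Rel_sub[of Y] by auto
  have sys: "indep_system S \<I>" using mat by (simp add: matroid_def)
  have "sum w (Greedy \<J> w Y \<inter> blocked S \<I> Y) \<le> real 1 * sum w (PCore S \<I> w ?R)"
  proof (rule sum_le_sum_if_upper_card_le[OF finite_ground inj_weight weight_nonneg])
    show "Greedy \<J> w Y \<inter> blocked S \<I> Y \<subseteq> T" using Greedy_sub[OF Y] Y by auto
    show "PCore S \<I> w ?R \<subseteq> T" using PCore_subset[of S \<I> w ?R] RT by auto
    fix t
    let ?X = "{b\<in>?R. w b > t}" and ?D = "{a\<in>Greedy \<J> w Y \<inter> blocked S \<I> Y. w a > t}"
    have XS: "?X \<subseteq> S" by auto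
    have "inj_on w ?X" using RT by (intro inj_sub) auto
    then have basis: "basis_of \<I> ?X (PCore S \<I> w ?X)"
      by (rule matroid_PCore_basis[OF mat XS])
    have "?D \<in> \<I>"
      by (rule indep_system_subset[OF sys assms(2)[OF Greedy_indep[OF Y]] upper_blocked_Greedy(1)[OF Y]])
    then have "card ?D \<le> card (PCore S \<I> w ?X)"
      by (rule matroid_card_hull_le[OF mat XS basis _ upper_blocked_Greedy(2,3)[OF Y]])
    then show "card ?D \<le> 1 * card {b\<in>PCore S \<I> w ?R. w b > t}"
      by (simp only: PCore_upper mult_1)
  qed
  \<comment> \<open>Both definitions test the same hull of heavier elements of \<open>?R\<close>, so
    the core is the complement of the blocked elements in \<open>?R\<close>.\<close>
  also have "PCore S \<I> w ?R = ?R - Rel T \<J> w Y \<inter> blocked S \<I> Y"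
    by (auto simp: PCore_def blocked_def)
  also have "real 1 * sum w (?R - Rel T \<J> w Y \<inter> blocked S \<I> Y) =
      sum w ?R - sum w (Rel T \<J> w Y \<inter> blocked S \<I> Y)"
    using finite_sub[OF RT] by (simp add: sum_diff blocked_def Int_def subset_eq)
  finally show ?thesis .
qed

text \<open>An element of \<open>Rel\<close> missing from the core is blocked in some component. If
  several components block it, it is overcounted, which is harmless as weights are
  nonnegative.\<close>

lemma sum_Rel_le_Core_blocked:
  "sum w (Rel T \<J> w Y) \<le> sum w (Core M S \<I> w (Rel T \<J> w Y)) +
    (\<Sum>j\<in>{1..M}. sum w (Rel T \<J> w Y \<inter> blocked (S j) (\<I> j) Y))"
proof -
  let ?R = "Rel T \<J> w Y" and ?L = "\<lambda>j. Rel T \<J> w Y \<inter> blocked (S j) (\<I> j) Y"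
  let ?C = "Core M S \<I> w ?R"
  have RT: "?R \<subseteq> T" using Rel_sub by auto
  have CR: "?C \<subseteq> ?R" by (auto simp: Core_def)
  have nonneg: "0 \<le> w e" if "e \<in> ?R" for e using that RT weight_nonneg by auto
  have finR: "finite ?R" using RT by (rule finite_sub)
  have inter: "(\<Sum>e\<in>?R. w e * of_bool (e \<in> B)) = sum w (?R \<inter> B)" for B
    using finR by (intro sum.mono_neutral_cong_right) auto
  have "w e \<le> w e * of_bool (e \<in> ?C) + (\<Sum>j\<in>{1..M}. w e * of_bool (e \<in> blocked (S j) (\<I> j) Y))"
    if e: "e \<in> ?R" for e
  proof (cases "\<exists>j\<in>{1..M}. e \<in> blocked (S j) (\<I> j) Y")
    case True
    then obtain j where j: "j \<in> {1..M}" "e \<in> blocked (S j) (\<I> j) Y" by blast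
    have "w e = w e * of_bool (e \<in> blocked (S j) (\<I> j) Y)" using j(2) by simp
    also have "\<dots> \<le> (\<Sum>j\<in>{1..M}. w e * of_bool (e \<in> blocked (S j) (\<I> j) Y))"
      using nonneg[OF e] by (intro member_le_sum[OF j(1)]) auto
    finally have "w e \<le> (\<Sum>j\<in>{1..M}. w e * of_bool (e \<in> blocked (S j) (\<I> j) Y))" .
    moreover have "0 \<le> w e * of_bool (e \<in> ?C)" using nonneg[OF e] by simp
    ultimately show ?thesis by linarith
  next
    case False
    then have "e \<in> ?C" using e by (auto simp: Core_def PCore_def blocked_def)
    then show ?thesis using nonneg[OF e] by (simp add: sum_nonneg)
  qed
  then have "sum w ?R \<le> (\<Sum>e\<in>?R. w e * of_bool (e \<in> ?C) +
      (\<Sum>j\<in>{1..M}. w e * of_bool (e \<in> blocked (S j) (\<I> j) Y)))"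
    by (rule sum_mono)
  also have "\<dots> = (\<Sum>e\<in>?R. w e * of_bool (e \<in> ?C)) +
      (\<Sum>j\<in>{1..M}. \<Sum>e\<in>?R. w e * of_bool (e \<in> blocked (S j) (\<I> j) Y))"
    by (simp only: sum.distrib sum.swap[of _ "{1..M}"])
  also have "\<dots> = sum w ?C + (\<Sum>j\<in>{1..M}. sum w (?L j))"
    using CR by (simp only: inter Int_absorb1)
  finally show ?thesis .
qed

end

section \<open>Combinations and the final estimate\<close>

lemma comb_indep_empty:
  assumes "\<And>j. j \<in> {1..M} \<Longrightarrow> indep_system (S j) (\<I> j)"
  shows "{} \<in> comb_indep M S \<I>"
proof -
  have "{} \<in> \<I> j" if "j \<in> {1..M}" for j
  proof -
    have "\<I> j \<noteq> {}" using assms[OF that] by (simp add: indep_system_def)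
    then obtain A where "A \<in> \<I> j" by auto
    then show ?thesis by (rule indep_system_subset[OF assms[OF that]]) simp
  qed
  then show ?thesis by (simp add: comb_indep_def)
qed

theorem lemma5:
  fixes M :: nat
    and S :: "nat \<Rightarrow> 'a set"
    and \<I> :: "nat \<Rightarrow> 'a set set"
    and k :: "nat \<Rightarrow> nat"
    and K :: nat
    and w :: "'a \<Rightarrow> real"
    and p :: real
    and T :: "'a set"
    and \<J> :: "'a set set"
  assumes "\<And>j. j \<in> {1..M} \<Longrightarrow> growth_system (k j) (S j) (\<I> j)"
    and "T = comb_ground M S"
    and "\<J> = comb_indep M S \<I>"
    and "inj_on w T"
    and "\<And>e. e \<in> T \<Longrightarrow> 0 \<le> w e"
    and "K = Max ((\<lambda>e. \<Sum>j\<in>{j\<in>{1..M}. e \<in> S j}. k j) ` T)"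
    and "0 < p" and "p \<le> 1"
  shows "measure_pmf.expectation (random_subset p T) (\<lambda>Y. sum w (Core M S \<I> w (Rel T \<J> w Y)))
           \<ge> (p - (1 - p) * real K) * (1 - p) / p\<^sup>2
             * measure_pmf.expectation (random_subset p T) (\<lambda>Y. sum w (Greedy \<J> w Y))
         \<and>
         ((\<forall>j\<in>{1..M}. matroid (S j) (\<I> j) \<and> k j = 1) \<longrightarrow>
          measure_pmf.expectation (random_subset p T) (\<lambda>Y. sum w (Core M S \<I> w (Rel T \<J> w Y)))
           \<ge> (p - (1 - p) * (real K - 1)) * (1 - p) / p
             * measure_pmf.expectation (random_subset p T) (\<lambda>Y. sum w (Greedy \<J> w Y)))"
proof -
  note growth = assms(1) and p = assms(7,8)
  have sys: "indep_system (S j) (\<I> j)" if "j \<in> {1..M}" for j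
    using growth[OF that] by (simp add: growth_system_def)
  have finite_T: "finite T"
    using indep_system_finite[OF sys] by (simp add: assms(2) comb_ground_def)
  interpret weighted_indep T \<J> w
    using finite_T comb_indep_empty[OF sys] assms(4,5) by unfold_locales (simp_all add: assms(3))
  have trace: "I \<inter> S j \<in> \<I> j" if "j \<in> {1..M}" "I \<in> \<J>" for I j
    using that by (simp add: assms(3) comb_indep_def)
  let ?E = "measure_pmf.expectation (random_subset p T)"
  define G where "G = ?E (\<lambda>Y. sum w (Greedy \<J> w Y))"
  define R where "R = ?E (\<lambda>Y. sum w (Rel T \<J> w Y))"
  define C where "C = ?E (\<lambda>Y. sum w (Core M S \<I> w (Rel T \<J> w Y)))"
  define RS where "RS j = ?E (\<lambda>Y. sum w (Rel T \<J> w Y \<inter> S j))" for j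
  define RB where "RB j = ?E (\<lambda>Y. sum w (Rel T \<J> w Y \<inter> blocked (S j) (\<I> j) Y))" for j
  define GB where "GB j = ?E (\<lambda>Y. sum w (Greedy \<J> w Y \<inter> blocked (S j) (\<I> j) Y))" for j

  have R_G: "p * R = (1 - p) * G"
    using expectation_Rel_Greedy_inter[of p "\<lambda>_. UNIV"] p by (simp add: R_def G_def)
  have RB_GB: "p * RB j = (1 - p) * GB j" for j
    unfolding RB_def GB_def
    using p by (intro expectation_Rel_Greedy_inter blocked_insert) auto

  have "R \<le> ?E (\<lambda>Y. sum w (Core M S \<I> w (Rel T \<J> w Y)) +
      (\<Sum>j\<in>{1..M}. sum w (Rel T \<J> w Y \<inter> blocked (S j) (\<I> j) Y)))"
    unfolding R_def
    by (rule expectation_random_subset_mono[OF finite_T]) (rule sum_Rel_le_Core_blocked)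
  also have "\<dots> = C + (\<Sum>j\<in>{1..M}. RB j)"
    unfolding C_def RB_def using finite_T
    by (subst Bochner_Integration.integral_add) (auto intro!: Bochner_Integration.integral_sum)
  finally have C_ge: "R - (\<Sum>j\<in>{1..M}. RB j) \<le> C" by simp

  \<comment> \<open>Double counting: \<open>e\<close> contributes its weight times the sum of
    \<open>k j\<close> over the components containing it, which is at most \<open>K\<close>. The
    bound by \<open>Max\<close> is invoked only for an \<open>e\<close> in \<open>T\<close>, so the
    unspecified value of \<open>K\<close> for empty \<open>T\<close> does no harm.\<close>
  have RS_sum: "(\<Sum>j\<in>{1..M}. real (k j) * RS j) \<le> real K * R"
  proof -
    have "(\<Sum>j\<in>{1..M}. real (k j) * sum w (X \<inter> S j)) \<le> real K * sum w X" if X: "X \<subseteq> T" for X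
    proof -
      have inter: "sum w (X \<inter> S j) = (\<Sum>e\<in>X. w e * of_bool (e \<in> S j))" for j
        using finite_sub[OF X] by (intro sum.mono_neutral_cong_left) auto
      have "(\<Sum>j\<in>{1..M}. real (k j) * sum w (X \<inter> S j)) =
          (\<Sum>e\<in>X. \<Sum>j\<in>{1..M}. real (k j) * (w e * of_bool (e \<in> S j)))"
        by (simp only: inter sum_distrib_left sum.swap[of _ X])
      also have "\<dots> = (\<Sum>e\<in>X. w e * real (\<Sum>j\<in>{j\<in>{1..M}. e \<in> S j}. k j))"
      proof (rule sum.cong[OF refl])
        fix e
        have "(\<Sum>j\<in>{j\<in>{1..M}. e \<in> S j}. w e * real (k j)) =
            (\<Sum>j\<in>{1..M}. real (k j) * (w e * of_bool (e \<in> S j)))"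
          by (rule sum.mono_neutral_cong_left) auto
        then show "(\<Sum>j\<in>{1..M}. real (k j) * (w e * of_bool (e \<in> S j))) =
            w e * real (\<Sum>j\<in>{j\<in>{1..M}. e \<in> S j}. k j)"
          by (simp only: of_nat_sum sum_distrib_left)
      qed
      also have "\<dots> \<le> (\<Sum>e\<in>X. w e * real K)"
      proof (rule sum_mono)
        fix e assume "e \<in> X"
        then have e: "e \<in> T" using X by auto
        then have "(\<Sum>j\<in>{j\<in>{1..M}. e \<in> S j}. k j) \<le> K"
          unfolding assms(6) using finite_T by (intro Max_ge) auto
        then show "w e * real (\<Sum>j\<in>{j\<in>{1..M}. e \<in> S j}. k j) \<le> w e * real K"
          using weight_nonneg[OF e] by (intro mult_left_mono of_nat_mono)
      qed
      also have "\<dots> = real K * sum w X"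
        by (simp only: sum_distrib_left mult.commute)
      finally show ?thesis .
    qed
    then have "?E (\<lambda>Y. \<Sum>j\<in>{1..M}. real (k j) * sum w (Rel T \<J> w Y \<inter> S j)) \<le>
        ?E (\<lambda>Y. real K * sum w (Rel T \<J> w Y))"
      using Rel_sub by (intro expectation_random_subset_mono[OF finite_T]) blast
    also have "?E (\<lambda>Y. \<Sum>j\<in>{1..M}. real (k j) * sum w (Rel T \<J> w Y \<inter> S j)) =
        (\<Sum>j\<in>{1..M}. ?E (\<lambda>Y. real (k j) * sum w (Rel T \<J> w Y \<inter> S j)))"
      using finite_T by (intro Bochner_Integration.integral_sum) simp
    finally show ?thesis by (simp add: RS_def R_def)
  qed

  have GB_le: "GB j \<le> real (k j) * RS j" if j: "j \<in> {1..M}" for j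
  proof -
    have "GB j \<le> ?E (\<lambda>Y. real (k j) * sum w (Rel T \<J> w Y \<inter> S j))"
      unfolding GB_def by (rule expectation_random_subset_mono[OF finite_T])
        (rule sum_Greedy_blocked_le[OF growth[OF j] trace[OF j]])
    then show ?thesis by (simp add: RS_def)
  qed
  have "p * (\<Sum>j\<in>{1..M}. RB j) = (1 - p) * (\<Sum>j\<in>{1..M}. GB j)"
    by (simp only: sum_distrib_left RB_GB)
  also have "\<dots> \<le> (1 - p) * (\<Sum>j\<in>{1..M}. real (k j) * RS j)"
    using p GB_le by (intro mult_left_mono sum_mono) auto
  also have "\<dots> \<le> (1 - p) * (real K * R)"
    using p RS_sum by (intro mult_left_mono) auto
  finally have RB_le: "p * (\<Sum>j\<in>{1..M}. RB j) \<le> (1 - p) * (real K * R)" .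

  have R_eq: "R = (1 - p) * G / p" using R_G p by (simp add: field_simps)
  \<comment> \<open>One factor (1 - p)/p turns \<open>G\<close> into \<open>R\<close>; what is left
    of the coefficient is 1 - (1 - p)K/p.\<close>
  have "(p - (1 - p) * real K) * (1 - p) / p\<^sup>2 * G = R - (1 - p) * (real K * R) / p"
    using p unfolding R_eq by (simp add: field_simps power2_eq_square)
  also have "\<dots> \<le> R - (\<Sum>j\<in>{1..M}. RB j)"
    using RB_le p by (simp add: field_simps)
  finally have general: "(p - (1 - p) * real K) * (1 - p) / p\<^sup>2 * G \<le> C"
    using C_ge by simp

  have "(p - (1 - p) * (real K - 1)) * (1 - p) / p * G \<le> C"
    if mat: "\<forall>j\<in>{1..M}. matroid (S j) (\<I> j) \<and> k j = 1"
  proof -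
    \<comment> \<open>From p \<open>RB j\<close> = (1 - p) \<open>GB j\<close> \<le> (1 -
      p)(\<open>RS j\<close> - \<open>RB j\<close>), the terms in \<open>RB j\<close> on the left
      add up to \<open>RB j\<close> itself. This saves the factor 1/p of the general case.\<close>
    have "RB j \<le> (1 - p) * (real (k j) * RS j)" if j: "j \<in> {1..M}" for j
    proof -
      have mat_j: "matroid (S j) (\<I> j)" "k j = 1" using mat j by auto
      have "GB j \<le> ?E (\<lambda>Y. sum w (Rel T \<J> w Y \<inter> S j) -
          sum w (Rel T \<J> w Y \<inter> blocked (S j) (\<I> j) Y))"
        unfolding GB_def by (rule expectation_random_subset_mono[OF finite_T])
          (rule sum_Greedy_blocked_le_matroid[OF mat_j(1) trace[OF j]])
      also have "\<dots> = RS j - RB j"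
        unfolding RS_def RB_def using finite_T by (intro Bochner_Integration.integral_diff) simp_all
      finally have "(1 - p) * GB j \<le> (1 - p) * (RS j - RB j)"
        using p by (intro mult_left_mono) auto
      then show ?thesis using RB_GB[of j] mat_j(2) by (simp add: algebra_simps)
    qed
    then have "(\<Sum>j\<in>{1..M}. RB j) \<le> (\<Sum>j\<in>{1..M}. (1 - p) * (real (k j) * RS j))"
      by (rule sum_mono)
    also have "\<dots> = (1 - p) * (\<Sum>j\<in>{1..M}. real (k j) * RS j)"
      by (simp only: sum_distrib_left)
    also have "\<dots> \<le> (1 - p) * (real K * R)"
      using p RS_sum by (intro mult_left_mono) auto
    finally have "R - (1 - p) * (real K * R) \<le> C" using C_ge by simp
    \<comment> \<open>The K - 1 arises from p - (1 - p)(K - 1) = 1 - (1 - p)K.\<close>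
    moreover have "(p - (1 - p) * (real K - 1)) * (1 - p) / p * G = R - (1 - p) * (real K * R)"
      unfolding R_eq using p by (simp add: field_simps)
    ultimately show ?thesis by simp
  qed
  with general show ?thesis unfolding C_def G_def by blast
qed

end
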